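(* Consider the equation $$x^4+y^4+z^4-2x^2y^2-2y^2z^2-2z^2x^2=1 .$$ (a) This equation has exactly six integer solutions with two of the variables being zero: $(\pm1,0,0)$, $(0,\pm1,0)$ and $(0,0,\pm1)$. These are also the only rational solutions with two of the variables being zero. (b) The equation has no integer solutions with only one of the variables being zero. (c) The set $S$ of rational solutions with only one of the variables being zero is the union of twelve classes $C_1,\dots,C_{12}$ described as follows. Let $k_1,k_2$ range over the relatively prime positive integers with $1\le k_2<k_1$ and $k_1+k_2\equiv 1\pmod 2$, and put $$e=\frac{k_1^2+k_2^2}{2k_1k_2},\quad f=\frac{k_1^2-k_2^2}{2k_1k_2},\quad g=\frac{k_1^2+k_2^2}{k_1^2-k_2^2},\quad h=\frac{2k_1k_2}{k_1^2-k_2^2}$$ (all four are positive). Then, over all such $k_1,k_2$ and with all sign combinations being possible: $C_1$ is the set of triples of the form $(\pm e,\pm f,0)$; $C_2$ of the form $(\pm e,0,\pm f)$; $C_3$ of the form $(\pm f,\pm e,0)$; $C_4$ of the form $(\pm f,0,\pm e)$; $C_5$ of the form $(0,\pm e,\pm f)$; $C_6$ of the form $(0,\pm f,\pm e)$; and $C_7,\dots,C_{12}$ are obtained from $C_1,\dots,C_6$, respectively, by replacing $e$ by $g$ and $f$ by $h$.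
   Context: "Only one of the variables being zero" means that exactly one of $x,y,z$ is zero and the other two are nonzero. *)

theory Defs
  imports Complex_Main
begin

definition solutions :: "('a::comm_ring_1 \<times> 'a \<times> 'a) set" where
  "solutions = {(x, y, z).
     x^4 + y^4 + z^4 - 2 * x^2 * y^2 - 2 * y^2 * z^2 - 2 * z^2 * x^2 = 1}"

text \<open>Exactly two, respectively exactly one, of the three coordinates vanish.\<close>

definition two_zero :: "('a::zero \<times> 'a \<times> 'a) set" where
  "two_zero = {(x, y, z).
     (x \<noteq> 0 \<and> y = 0 \<and> z = 0) \<or> (x = 0 \<and> y \<noteq> 0 \<and> z = 0) \<or> (x = 0 \<and> y = 0 \<and> z \<noteq> 0)}"

definition one_zero :: "('a::zero \<times> 'a \<times> 'a) set" where
  "one_zero = {(x, y, z).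
     (x = 0 \<and> y \<noteq> 0 \<and> z \<noteq> 0) \<or> (x \<noteq> 0 \<and> y = 0 \<and> z \<noteq> 0) \<or> (x \<noteq> 0 \<and> y \<noteq> 0 \<and> z = 0)}"

definition params :: "(nat \<times> nat) set" where
  "params = {(k1, k2). 1 \<le> k2 \<and> k2 < k1 \<and> coprime k1 k2 \<and> (k1 + k2) mod 2 = 1}"

text \<open>The arguments are embedded into the rationals before subtracting, so no truncation occurs.\<close>

definition e_par :: "nat \<Rightarrow> nat \<Rightarrow> rat" where
  "e_par k1 k2 = ((of_nat k1)^2 + (of_nat k2)^2) / (2 * of_nat k1 * of_nat k2)"

definition f_par :: "nat \<Rightarrow> nat \<Rightarrow> rat" where
  "f_par k1 k2 = ((of_nat k1)^2 - (of_nat k2)^2) / (2 * of_nat k1 * of_nat k2)"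

definition g_par :: "nat \<Rightarrow> nat \<Rightarrow> rat" where
  "g_par k1 k2 = ((of_nat k1)^2 + (of_nat k2)^2) / ((of_nat k1)^2 - (of_nat k2)^2)"

definition h_par :: "nat \<Rightarrow> nat \<Rightarrow> rat" where
  "h_par k1 k2 = (2 * of_nat k1 * of_nat k2) / ((of_nat k1)^2 - (of_nat k2)^2)"

definition pm :: "rat \<Rightarrow> rat set" where
  "pm a = {a, - a}"

text \<open>The two signs are chosen independently.  Each class is taken for \<open>(u, v) = (e_par, f_par)\<close>
  and for \<open>(u, v) = (g_par, h_par)\<close>, which gives twelve classes in total.\<close>

definition class1 :: "(nat \<Rightarrow> nat \<Rightarrow> rat) \<Rightarrow> (nat \<Rightarrow> nat \<Rightarrow> rat) \<Rightarrow> (rat \<times> rat \<times> rat) set" where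
  "class1 u v = (\<Union>(k1, k2)\<in>params. pm (u k1 k2) \<times> pm (v k1 k2) \<times> {0})"

definition class2 :: "(nat \<Rightarrow> nat \<Rightarrow> rat) \<Rightarrow> (nat \<Rightarrow> nat \<Rightarrow> rat) \<Rightarrow> (rat \<times> rat \<times> rat) set" where
  "class2 u v = (\<Union>(k1, k2)\<in>params. pm (u k1 k2) \<times> {0} \<times> pm (v k1 k2))"

definition class3 :: "(nat \<Rightarrow> nat \<Rightarrow> rat) \<Rightarrow> (nat \<Rightarrow> nat \<Rightarrow> rat) \<Rightarrow> (rat \<times> rat \<times> rat) set" where
  "class3 u v = (\<Union>(k1, k2)\<in>params. pm (v k1 k2) \<times> pm (u k1 k2) \<times> {0})"

definition class4 :: "(nat \<Rightarrow> nat \<Rightarrow> rat) \<Rightarrow> (nat \<Rightarrow> nat \<Rightarrow> rat) \<Rightarrow> (rat \<times> rat \<times> rat) set" where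
  "class4 u v = (\<Union>(k1, k2)\<in>params. pm (v k1 k2) \<times> {0} \<times> pm (u k1 k2))"

definition class5 :: "(nat \<Rightarrow> nat \<Rightarrow> rat) \<Rightarrow> (nat \<Rightarrow> nat \<Rightarrow> rat) \<Rightarrow> (rat \<times> rat \<times> rat) set" where
  "class5 u v = (\<Union>(k1, k2)\<in>params. {0} \<times> pm (u k1 k2) \<times> pm (v k1 k2))"

definition class6 :: "(nat \<Rightarrow> nat \<Rightarrow> rat) \<Rightarrow> (nat \<Rightarrow> nat \<Rightarrow> rat) \<Rightarrow> (rat \<times> rat \<times> rat) set" where
  "class6 u v = (\<Union>(k1, k2)\<in>params. {0} \<times> pm (v k1 k2) \<times> pm (u k1 k2))"

end

theory Submission
  imports Defs
begin

text \<open>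
  Setting one variable to zero turns the quartic form into a perfect square: the equation becomes
  \<open>(x^2 - y^2)^2 = 1\<close>, that is \<open>x^2 - y^2 = 1\<close> or \<open>y^2 - x^2 = 1\<close>.  Solutions
  with a vanishing variable are therefore points of the hyperbola \<open>u^2 - v^2 = 1\<close>.

  With two vanishing variables what remains is \<open>x^4 = 1\<close>, whose only roots in an ordered
  domain are \<open>1\<close> and \<open>-1\<close>.

  Over the integers \<open>(u + v) (u - v) = 1\<close> forces \<open>v = 0\<close>, so no solution has exactly
  one vanishing variable.

  Over the rationals the hyperbola is parametrized by \<open>t = u + v\<close>, since then
  \<open>u - v = 1 / t\<close>.  The points with \<open>u, v > 0\<close> are those with \<open>t > 1\<close>; write
  \<open>t = a / b\<close> in lowest terms.  If \<open>a\<close> and \<open>b\<close> have opposite parity, then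
  \<open>(a, b)\<close> is itself an admissible parameter pair and the point is \<open>(e, f)\<close>.  Otherwise both
  are odd, and the admissible pair \<open>k1 = (a + b) / 2\<close>, \<open>k2 = (a - b) / 2\<close> gives the point
  \<open>(g, h)\<close>; this is where the second family of six classes comes from.  The signs of \<open>u\<close> and
  \<open>v\<close> are free, and the six classes in each family record which variable vanishes and which of
  the other two plays the role of \<open>u\<close>.
\<close>

lemma quartic_with_zero_iff:
  fixes u v :: "'a::linordered_idom"
  shows "u^4 + v^4 - 2 * u^2 * v^2 = 1 \<longleftrightarrow> u^2 - v^2 = 1 \<or> v^2 - u^2 = 1"
proof -
  have "u^4 + v^4 - 2 * u^2 * v^2 = (u^2 - v^2)^2"
    by (simp add: power2_eq_square power4_eq_xxxx algebra_simps)
  then show ?thesis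
    by (auto simp: power2_eq_1_iff)
qed

text \<open>
  The order excludes \<open>x^2 = -1\<close>; stating this for ordered domains treats the integers and
  the rationals at once.
\<close>

lemma fourth_power_eq_1_iff:
  fixes x :: "'a::linordered_idom"
  shows "x^4 = 1 \<longleftrightarrow> x = 1 \<or> x = -1"
proof -
  have "x^4 = (x^2)^2"
    by (simp add: power2_eq_square power4_eq_xxxx mult.assoc)
  then have "x^4 = 1 \<longleftrightarrow> x^2 = 1 \<or> x^2 = -1"
    by (simp only: power2_eq_1_iff)
  moreover have "x^2 \<noteq> -1"
    by (metis zero_le_power2 neg_0_le_iff_le not_one_le_zero)
  ultimately show ?thesis
    by (simp only: power2_eq_1_iff simp_thms)
qed

lemma solutions_two_zero:
  "(solutions \<inter> two_zero :: ('a::linordered_idom \<times> 'a \<times> 'a) set) =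
     {(1, 0, 0), (-1, 0, 0), (0, 1, 0), (0, -1, 0), (0, 0, 1), (0, 0, -1)}"
  by (auto simp: solutions_def two_zero_def fourth_power_eq_1_iff)

lemma solutions_one_zero_iff:
  fixes x y z :: "'a::linordered_idom"
  shows "(x, y, z) \<in> solutions \<inter> one_zero \<longleftrightarrow>
    (x = 0 \<and> y \<noteq> 0 \<and> z \<noteq> 0 \<and> (y^2 - z^2 = 1 \<or> z^2 - y^2 = 1)) \<or>
    (y = 0 \<and> x \<noteq> 0 \<and> z \<noteq> 0 \<and> (x^2 - z^2 = 1 \<or> z^2 - x^2 = 1)) \<or>
    (z = 0 \<and> x \<noteq> 0 \<and> y \<noteq> 0 \<and> (x^2 - y^2 = 1 \<or> y^2 - x^2 = 1))"
proof -
  have "x = 0 \<Longrightarrow> (x, y, z) \<in> solutions \<longleftrightarrow> y^2 - z^2 = 1 \<or> z^2 - y^2 = 1"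
    using quartic_with_zero_iff[of y z] by (simp add: solutions_def algebra_simps)
  moreover have "y = 0 \<Longrightarrow> (x, y, z) \<in> solutions \<longleftrightarrow> x^2 - z^2 = 1 \<or> z^2 - x^2 = 1"
    using quartic_with_zero_iff[of x z] by (simp add: solutions_def algebra_simps)
  moreover have "z = 0 \<Longrightarrow> (x, y, z) \<in> solutions \<longleftrightarrow> x^2 - y^2 = 1 \<or> y^2 - x^2 = 1"
    using quartic_with_zero_iff[of x y] by (simp add: solutions_def algebra_simps)
  ultimately show ?thesis
    by (auto simp: one_zero_def)
qed

lemma int_hyperbola_imp_zero:
  fixes u v :: int
  assumes "u^2 - v^2 = 1"
  shows "v = 0"
proof -
  have "(u + v) * (u - v) = 1"
    using assms by (simp add: power2_eq_square algebra_simps)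
  then show ?thesis
    by (auto simp: zmult_eq_1_iff)
qed

lemma par_pos:
  assumes "(k1, k2) \<in> params"
  shows "0 < e_par k1 k2" "0 < f_par k1 k2" "0 < g_par k1 k2" "0 < h_par k1 k2"
proof -
  have k: "(0::rat) < of_nat k2" "of_nat k2 < (of_nat k1 :: rat)"
    using assms by (auto simp: params_def)
  then have sq: "(of_nat k2)^2 < (of_nat k1 :: rat)^2"
    by (intro power_strict_mono) auto
  show "0 < e_par k1 k2" "0 < f_par k1 k2" "0 < g_par k1 k2" "0 < h_par k1 k2"
    unfolding e_par_def f_par_def g_par_def h_par_def
    using k sq by (auto intro!: divide_pos_pos add_pos_pos mult_pos_pos)
qed

lemma par_on_hyperbola:
  assumes "(k1, k2) \<in> params"
  shows "(e_par k1 k2)^2 - (f_par k1 k2)^2 = 1" "(g_par k1 k2)^2 - (h_par k1 k2)^2 = 1"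
proof -
  define a b where "a = (of_nat k1 :: rat)" and "b = (of_nat k2 :: rat)"
  have ab: "0 < b" "b < a"
    using assms by (auto simp: params_def a_def b_def)
  then have "b^2 < a^2"
    by (intro power_strict_mono) auto
  \<comment> \<open>Both equations are this identity, divided by one or the other square on its right.\<close>
  have pyth: "(a^2 + b^2)^2 = (2 * a * b)^2 + (a^2 - b^2)^2"
    by (simp add: power2_eq_square algebra_simps)
  have "2 * a * b \<noteq> 0" "a^2 - b^2 \<noteq> 0"
    using ab \<open>b^2 < a^2\<close> by auto
  then show "(e_par k1 k2)^2 - (f_par k1 k2)^2 = 1" "(g_par k1 k2)^2 - (h_par k1 k2)^2 = 1"
    unfolding e_par_def f_par_def g_par_def h_par_def a_def[symmetric] b_def[symmetric]
    by (simp_all only: power_divide diff_divide_distrib[symmetric] pyth) simp_all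
qed

text \<open>
  The ratio \<open>t = a / b\<close> is \<open>u + v\<close>.  When \<open>a\<close> and \<open>b\<close> are both odd, the
  substitution \<open>a = k1 + k2\<close>, \<open>b = k1 - k2\<close> turns \<open>a^2 + b^2\<close>, \<open>2 a b\<close> and
  \<open>a^2 - b^2\<close> into twice \<open>k1^2 + k2^2\<close>, \<open>k1^2 - k2^2\<close> and \<open>2 k1 k2\<close>, so that the two
  legs of the Pythagorean triple change places.  The sum \<open>k1 + k2 = a\<close> is odd, and a common
  divisor of \<open>k1\<close> and \<open>k2\<close> divides both \<open>a\<close> and \<open>b\<close>.
\<close>

lemma pos_hyperbola_imp_par:
  fixes u v :: rat
  assumes hyp: "u^2 - v^2 = 1" and pos: "0 < u" "0 < v"
  shows "\<exists>(k1, k2)\<in>params.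
    (u = e_par k1 k2 \<and> v = f_par k1 k2) \<or> (u = g_par k1 k2 \<and> v = h_par k1 k2)"
proof -
  obtain n d :: int where nd: "u + v = of_int n / of_int d" "0 < d" "coprime n d"
    using quotient_of_div quotient_of_denom_pos quotient_of_coprime
    by (metis surj_pair)
  have "0 < u + v"
    using pos by simp
  then have "0 < n"
    using nd by (simp add: zero_less_divide_iff)
  define a b where "a = nat n" and "b = nat d"
  define A B where "A = (of_nat a :: rat)" and "B = (of_nat b :: rat)"
  have "coprime a b"
    using nd \<open>0 < n\<close> by (simp add: a_def b_def coprime_int_iff[symmetric])
  have AB: "u + v = A / B" "0 < A" "0 < B"
    using nd \<open>0 < n\<close> by (auto simp: A_def B_def a_def b_def)
  have "(u + v) * (u - v) = 1"
    using hyp by (simp add: power2_eq_square algebra_simps)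
  then have "u - v = B / A"
    using AB by (simp add: field_simps)
  moreover have "u = ((u + v) + (u - v)) / 2" "v = ((u + v) - (u - v)) / 2"
    by simp_all
  ultimately have "u = (A / B + B / A) / 2" "v = (A / B - B / A) / 2"
    using AB(1) by simp_all
  then have uv: "u = (A^2 + B^2) / (2 * A * B)" "v = (A^2 - B^2) / (2 * A * B)"
    using AB by (simp_all add: field_simps power2_eq_square)
  have "B^2 < A^2"
    using pos(2) mult_pos_pos[OF AB(2,3)] unfolding uv(2) by (auto simp: zero_less_divide_iff)
  then have "B < A"
    using AB by (simp add: power2_less_imp_less)
  then have "b < a" "1 \<le> b"
    using AB by (auto simp: A_def B_def)
  show ?thesis
  proof (cases "odd (a + b)")
    case True
    then have "(a + b) mod 2 = 1"
      by presburger
    then have "(a, b) \<in> params"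
      using \<open>b < a\<close> \<open>1 \<le> b\<close> \<open>coprime a b\<close> by (simp add: params_def)
    moreover have "u = e_par a b" "v = f_par a b"
      using uv by (simp_all add: e_par_def f_par_def A_def B_def)
    ultimately show ?thesis
      by blast
  next
    case False
    \<comment> \<open>Two even numbers would not be coprime.\<close>
    with \<open>coprime a b\<close> have "odd a" "odd b"
      using coprime_common_divisor_nat[of a b 2] by auto
    define k1 k2 where "k1 = (a + b) div 2" and "k2 = (a - b) div 2"
    have k: "a = k1 + k2" "k1 = k2 + b"
      using \<open>odd a\<close> \<open>odd b\<close> \<open>b < a\<close> unfolding k1_def k2_def by presburger+
    have "1 \<le> k2"
      using k \<open>b < a\<close> \<open>odd a\<close> \<open>odd b\<close> by presburger
    have "coprime k1 k2"
    proof (rule coprimeI)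
      fix c assume c: "c dvd k1" "c dvd k2"
      then have "c dvd a"
        using k(1) by simp
      moreover have "c dvd b"
        using c k(2) by (metis dvd_add_right_iff)
      ultimately show "is_unit c"
        using \<open>coprime a b\<close> coprime_common_divisor by blast
    qed
    moreover have "(k1 + k2) mod 2 = 1"
      using k(1) \<open>odd a\<close> by presburger
    ultimately have "(k1, k2) \<in> params"
      using k(2) \<open>1 \<le> b\<close> \<open>1 \<le> k2\<close> by (simp add: params_def)
    moreover
    define p q where "p = (of_nat k1 :: rat)" and "q = (of_nat k2 :: rat)"
    have pq: "A = p + q" "B = p - q"
      using k(2) by (simp_all add: A_def B_def p_def q_def k(1))
    have dbl: "A^2 + B^2 = 2 * (p^2 + q^2)" "A^2 - B^2 = 2 * (2 * p * q)"
      "2 * A * B = 2 * (p^2 - q^2)"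
      by (simp_all add: pq power2_eq_square algebra_simps)
    have "u = g_par k1 k2" "v = h_par k1 k2"
      unfolding uv g_par_def h_par_def p_def[symmetric] q_def[symmetric] dbl
      by (rule mult_divide_mult_cancel_left, simp)+
    ultimately show ?thesis
      by blast
  qed
qed

lemma mem_pm_iff: "u \<in> pm a \<longleftrightarrow> \<bar>u\<bar> = \<bar>a\<bar>"
  by (auto simp: pm_def abs_if)

text \<open>
  The hyperbola is symmetric in both axes, so the sign choices are accounted for by passing to
  absolute values.
\<close>

lemma hyperbola_iff_par:
  fixes u v :: rat
  shows "u \<noteq> 0 \<and> v \<noteq> 0 \<and> u^2 - v^2 = 1 \<longleftrightarrow>
    (\<exists>(k1, k2)\<in>params. (u \<in> pm (e_par k1 k2) \<and> v \<in> pm (f_par k1 k2)) \<or>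
                        (u \<in> pm (g_par k1 k2) \<and> v \<in> pm (h_par k1 k2)))"
    (is "?L \<longleftrightarrow> ?R")
proof
  assume ?L
  then have "\<bar>u\<bar>^2 - \<bar>v\<bar>^2 = 1" "0 < \<bar>u\<bar>" "0 < \<bar>v\<bar>"
    by simp_all
  from pos_hyperbola_imp_par[OF this] obtain k1 k2 where k: "(k1, k2) \<in> params"
    "(\<bar>u\<bar> = e_par k1 k2 \<and> \<bar>v\<bar> = f_par k1 k2) \<or> (\<bar>u\<bar> = g_par k1 k2 \<and> \<bar>v\<bar> = h_par k1 k2)"
    by auto
  with par_pos[OF k(1)] show ?R
    by (intro bexI[OF _ k(1)]) (auto simp: mem_pm_iff)
next
  assume ?R
  then obtain k1 k2 where k: "(k1, k2) \<in> params"
    "(u \<in> pm (e_par k1 k2) \<and> v \<in> pm (f_par k1 k2)) \<or>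
     (u \<in> pm (g_par k1 k2) \<and> v \<in> pm (h_par k1 k2))"
    by auto
  with par_pos[OF k(1)] par_on_hyperbola[OF k(1)] show ?L
    by (auto simp: pm_def)
qed

lemma solutions_one_zero_int: "(solutions \<inter> one_zero :: (int \<times> int \<times> int) set) = {}"
proof -
  have "(x, y, z) \<notin> solutions \<inter> one_zero" for x y z :: int
    using int_hyperbola_imp_zero unfolding solutions_one_zero_iff by blast
  then show ?thesis
    by auto
qed

lemma solutions_one_zero_rat:
  "(solutions \<inter> one_zero :: (rat \<times> rat \<times> rat) set) =
     class1 e_par f_par \<union> class2 e_par f_par \<union> class3 e_par f_par \<union>
     class4 e_par f_par \<union> class5 e_par f_par \<union> class6 e_par f_par \<union>
     class1 g_par h_par \<union> class2 g_par h_par \<union> class3 g_par h_par \<union>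
     class4 g_par h_par \<union> class5 g_par h_par \<union> class6 g_par h_par"
    (is "_ = ?C")
proof -
  define H where "H u v \<longleftrightarrow> u \<noteq> 0 \<and> v \<noteq> 0 \<and> u^2 - v^2 = 1" for u v :: rat
  define P where "P p q u v \<longleftrightarrow> (\<exists>(k1, k2)\<in>params. u \<in> pm (p k1 k2) \<and> v \<in> pm (q k1 k2))"
    for p q and u v :: rat
  have H_iff: "H u v \<longleftrightarrow> P e_par f_par u v \<or> P g_par h_par u v" for u v
    unfolding H_def hyperbola_iff_par P_def by blast
  have mem_class:
    "(x, y, z) \<in> class1 p q \<longleftrightarrow> z = 0 \<and> P p q x y"
    "(x, y, z) \<in> class2 p q \<longleftrightarrow> y = 0 \<and> P p q x z"
    "(x, y, z) \<in> class3 p q \<longleftrightarrow> z = 0 \<and> P p q y x"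
    "(x, y, z) \<in> class4 p q \<longleftrightarrow> y = 0 \<and> P p q z x"
    "(x, y, z) \<in> class5 p q \<longleftrightarrow> x = 0 \<and> P p q y z"
    "(x, y, z) \<in> class6 p q \<longleftrightarrow> x = 0 \<and> P p q z y" for x y z p q
    by (auto simp: P_def class1_def class2_def class3_def class4_def class5_def class6_def)
  have "(x, y, z) \<in> solutions \<inter> one_zero \<longleftrightarrow> (x, y, z) \<in> ?C" for x y z :: rat
  proof -
    have "(x, y, z) \<in> solutions \<inter> one_zero \<longleftrightarrow>
        (x = 0 \<and> (H y z \<or> H z y)) \<or> (y = 0 \<and> (H x z \<or> H z x)) \<or> (z = 0 \<and> (H x y \<or> H y x))"
      unfolding solutions_one_zero_iff H_def by blast
    also have "\<dots> \<longleftrightarrow> (x, y, z) \<in> ?C"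
      unfolding H_iff Un_iff mem_class by blast
    finally show ?thesis .
  qed
  then show ?thesis
    by (simp only: set_eq_iff split_paired_All) blast
qed

theorem theorem10:
  shows "((solutions \<inter> two_zero :: (int \<times> int \<times> int) set) =
           {(1, 0, 0), (-1, 0, 0), (0, 1, 0), (0, -1, 0), (0, 0, 1), (0, 0, -1)}) \<and>
    (card (solutions \<inter> two_zero :: (int \<times> int \<times> int) set) = 6) \<and>
    ((solutions \<inter> two_zero :: (rat \<times> rat \<times> rat) set) =
           {(1, 0, 0), (-1, 0, 0), (0, 1, 0), (0, -1, 0), (0, 0, 1), (0, 0, -1)}) \<and>
    ((solutions \<inter> one_zero :: (int \<times> int \<times> int) set) = {}) \<and>
    (\<forall>(k1, k2)\<in>params.
           0 < e_par k1 k2 \<and> 0 < f_par k1 k2 \<and> 0 < g_par k1 k2 \<and> 0 < h_par k1 k2) \<and>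
    ((solutions \<inter> one_zero :: (rat \<times> rat \<times> rat) set) =
           class1 e_par f_par \<union> class2 e_par f_par \<union> class3 e_par f_par \<union>
           class4 e_par f_par \<union> class5 e_par f_par \<union> class6 e_par f_par \<union>
           class1 g_par h_par \<union> class2 g_par h_par \<union> class3 g_par h_par \<union>
           class4 g_par h_par \<union> class5 g_par h_par \<union> class6 g_par h_par)"
  unfolding solutions_two_zero solutions_one_zero_int solutions_one_zero_rat
  using par_pos by auto

end
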